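(* Let $A \in \mathbb{Z}^{m \times n}$ and let $H = \operatorname{HNF}(A)$ be its Hermite normal form. Then $A$ is decomposable if and only if $H$ is decomposable.
   Context: A unimodular matrix is a square integer matrix with determinant $\pm 1$. The direct sum $A_1 \oplus \cdots \oplus A_t$ of matrices is the block-diagonal matrix with diagonal blocks $A_1,\ldots,A_t$ (not necessarily square) and zeros elsewhere. A matrix "decomposes into a direct sum of matrices" if it equals $A_1 \oplus \cdots \oplus A_t$ for some $t \geq 2$ and matrices $A_i$ each having at least one row and at least one column. Decomposable: a matrix $A \in \mathbb{Z}^{m \times n}$ is decomposable if there exist a unimodular matrix $P$ (of size $m \times m$) and a permutation matrix $Q$ (of size $n \times n$) such that $P^{-1} A Q$ decomposes into a direct sum of matrices. Hermite normal form: for $A \in \mathbb{Z}^{m \times n}$ of rank $r$, $\operatorname{HNF}(A)$ is the unique matrix $H = (h_{ij}) \in \mathbb{Z}^{m \times n}$ such that $A = PH$ for some unimodular matrix $P$ and: (a) there is a sequence of integers $1 \leq j_1 < \cdots < j_r \leq n$ such that for each $1 \leq i \leq r$ we have $h_{ij} = 0$ for all $j < j_i$, and the pivot $h_{i\,j_i}$ is positive; (b) for $1 \leq k < i \leq r$ we have $0 \leq h_{k\,j_i} < h_{i\,j_i}$; (c) the last $m-r$ rows of $H$ are zero. *)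

theory Defs
  imports
    "Jordan_Normal_Form.Matrix"
    "Jordan_Normal_Form.Determinant"
    "Jordan_Normal_Form.DL_Rank"
    "HOL-Combinatorics.Permutations"
begin

definition unimodular :: "nat \<Rightarrow> int mat \<Rightarrow> bool" where
  "unimodular n P \<longleftrightarrow> P \<in> carrier_mat n n \<and> (det P = 1 \<or> det P = -1)"

definition permutation_matrix :: "nat \<Rightarrow> int mat \<Rightarrow> bool" where
  "permutation_matrix n Q \<longleftrightarrow>
     (\<exists>p. p permutes {..<n} \<and> Q = mat n n (\<lambda>(i, j). if i = p j then 1 else 0))"

definition decomposes_into_direct_sum :: "int mat \<Rightarrow> bool" where
  "decomposes_into_direct_sum A \<longleftrightarrow>
     (\<exists>As. length As \<ge> 2 \<and> (\<forall>B\<in>set As. dim_row B \<ge> 1 \<and> dim_col B \<ge> 1) \<and>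
        A = diag_block_mat As)"

text \<open>
  The library inverse \<open>mat_inverse\<close> is only available over fields, so the inverse of the
  unimodular matrix \<open>P\<close> is the two-sided inverse \<open>P'\<close> over the integers.
\<close>

definition decomposable :: "int mat \<Rightarrow> bool" where
  "decomposable A \<longleftrightarrow>
     (\<exists>P P' Q. unimodular (dim_row A) P \<and>
        P' \<in> carrier_mat (dim_row A) (dim_row A) \<and> inverts_mat P P' \<and> inverts_mat P' P \<and>
        permutation_matrix (dim_col A) Q \<and>
        decomposes_into_direct_sum (P' * A * Q))"

definition int_mat_rank :: "int mat \<Rightarrow> nat" where
  "int_mat_rank A = vec_space.rank (dim_row A) (map_mat rat_of_int A)"

text \<open>
  Rows and columns are indexed from 0: the pivot of row \<open>i < r\<close> is in column \<open>piv i\<close>,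
  and the zero rows are those with index \<open>r \<le> i < dim_row A\<close>.
\<close>

definition is_hermite_normal_form :: "int mat \<Rightarrow> int mat \<Rightarrow> bool" where
  "is_hermite_normal_form A H \<longleftrightarrow>
     H \<in> carrier_mat (dim_row A) (dim_col A) \<and>
     (\<exists>P. unimodular (dim_row A) P \<and> A = P * H) \<and>
     (let r = int_mat_rank A in
       (\<exists>piv :: nat \<Rightarrow> nat.
          strict_mono_on {..<r} piv \<and> (\<forall>i<r. piv i < dim_col A) \<and>
          (\<forall>i<r. (\<forall>j<piv i. H $$ (i, j) = 0) \<and> 0 < H $$ (i, piv i)) \<and>
          (\<forall>i<r. \<forall>k<i. 0 \<le> H $$ (k, piv i) \<and> H $$ (k, piv i) < H $$ (i, piv i))) \<and>
       (\<forall>i j. r \<le> i \<longrightarrow> i < dim_row A \<longrightarrow> j < dim_col A \<longrightarrow> H $$ (i, j) = 0))"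

definition hermite_normal_form :: "int mat \<Rightarrow> int mat" where
  "hermite_normal_form A = (THE H. is_hermite_normal_form A H)"

end

theory Submission
  imports Defs
begin

text \<open>
  Decomposability only asks for some unimodular \<open>P\<close> and permutation \<open>Q\<close> that put \<open>P\<^sup>-\<^sup>1 A Q\<close>
  into block form, so multiplying \<open>A\<close> on the left by a unimodular matrix is absorbed into the
  choice of \<open>P\<close> (\<open>decomposable_row_equiv\<close>). Since \<open>A = P H\<close> for the Hermite normal form
  \<open>H\<close>, this is the whole argument, once \<open>H\<close> is known to satisfy its defining property. As
  \<open>hermite_normal_form\<close> is a definite description, that requires existence and uniqueness of the
  normal form, and most of the work goes there.

  Existence (\<open>hermite_shape_exists\<close>) treats the columns from left to right. In place of the
  Euclidean algorithm, a new pivot is a nonzero entry of least absolute value that row operations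
  can produce in the column below the earlier pivots: the remainders modulo this pivot are smaller,
  so those below it must vanish, and those above it lie in the range that is required there.

  Uniqueness (\<open>hermite_shape_unique\<close>) reads the form off the lattice spanned by the rows, which
  row equivalence preserves. A nonzero lattice vector has its first nonzero entry in a pivot column,
  and this entry is a multiple of the pivot (\<open>row_lattice_leading_entry\<close>). Hence the lattice
  determines the pivot columns and the pivots; and if two rows with the same index differed, their
  difference would start with a nonzero multiple of a pivot, although both entries are residues
  modulo that pivot.

  Finally, the definition counts the pivots by the rational rank of \<open>A\<close>. The \<open>r\<close> nonzero rows of
  \<open>H\<close> give a factorisation through dimension \<open>r\<close>, and the \<open>r\<close> pivot columns are independent, so
  the two numbers agree (\<open>hermite_shape_rank\<close>).
\<close>

section \<open>Unimodular matrices and row equivalence\<close>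

text \<open>
  By Cramer's rule the adjugate is an integer inverse up to the factor \<open>det P\<close>, which is its own
  inverse.
\<close>

lemma unimodular_inverse:
  assumes "unimodular n P"
  obtains P' where "unimodular n P'" "P * P' = 1\<^sub>m n" "P' * P = 1\<^sub>m n"
proof
  let ?P' = "det P \<cdot>\<^sub>m adj_mat P"
  have P: "P \<in> carrier_mat n n" and d: "det P * det P = 1"
    using assms by (auto simp: unimodular_def)
  have P': "?P' \<in> carrier_mat n n"
    using adj_mat(1)[OF P] by simp
  have smult_smult: "det P \<cdot>\<^sub>m (det P \<cdot>\<^sub>m 1\<^sub>m n) = 1\<^sub>m n"
    using d by (intro eq_matI) (auto simp: mult.assoc[symmetric])
  show PP': "P * ?P' = 1\<^sub>m n"
    using P adj_mat(1,2)[OF P]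
    by (simp add: mult_smult_distrib[of _ n n _ n] smult_smult)
  show P'P: "?P' * P = 1\<^sub>m n"
    using P adj_mat(1,3)[OF P]
    by (simp add: mult_smult_assoc_mat[of _ n n _ n] smult_smult)
  have "det P * det ?P' = 1"
    using det_mult[OF P P'] PP' by simp
  then show "unimodular n ?P'"
    using P' by (auto simp: unimodular_def zmult_eq_1_iff)
qed

lemma unimodular_mult: "unimodular n P \<Longrightarrow> unimodular n Q \<Longrightarrow> unimodular n (P * Q)"
  by (auto simp: unimodular_def det_mult)

lemma unimodular_one: "unimodular n (1\<^sub>m n)"
  by (simp add: unimodular_def)

definition row_equiv :: "int mat \<Rightarrow> int mat \<Rightarrow> bool" where
  "row_equiv A B \<longleftrightarrow> (\<exists>P. unimodular (dim_row B) P \<and> A = P * B)"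

lemma row_equiv_dim:
  assumes "row_equiv A B"
  shows "dim_row A = dim_row B" "dim_col A = dim_col B"
  using assms by (auto simp: row_equiv_def unimodular_def)

lemma row_equiv_refl: "row_equiv A A"
  unfolding row_equiv_def using unimodular_one by (metis left_mult_one_mat')

lemma row_equiv_trans:
  assumes "row_equiv A B" "row_equiv B C"
  shows "row_equiv A C"
proof -
  obtain P Q where "unimodular (dim_row B) P" "A = P * B" "unimodular (dim_row C) Q" "B = Q * C"
    using assms by (auto simp: row_equiv_def)
  moreover have "dim_row B = dim_row C"
    using assms by (auto dest: row_equiv_dim)
  ultimately have "unimodular (dim_row C) (P * Q)" "A = (P * Q) * C"
    using unimodular_mult by (auto simp: unimodular_def intro!: assoc_mult_mat[symmetric])
  then show ?thesis
    by (auto simp: row_equiv_def)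
qed

lemma row_equiv_sym:
  assumes "row_equiv A B"
  shows "row_equiv B A"
proof -
  obtain P where P: "unimodular (dim_row B) P" "A = P * B"
    using assms by (auto simp: row_equiv_def)
  obtain P' where P': "unimodular (dim_row B) P'" "P' * P = 1\<^sub>m (dim_row B)"
    using unimodular_inverse[OF P(1)] by metis
  have "P' * A = (P' * P) * B"
    using P P'(1) by (auto simp: unimodular_def intro!: assoc_mult_mat[symmetric])
  then have "B = P' * A"
    using P' by simp
  then show ?thesis
    using P'(1) row_equiv_dim[OF assms] by (auto simp: row_equiv_def)
qed

text \<open>
  If \<open>A = P B\<close> and \<open>R\<close> decomposes \<open>B\<close>, then \<open>P R\<close> decomposes \<open>A\<close> into the very same blocks,
  because \<open>(P R)\<^sup>-\<^sup>1 A = R\<^sup>-\<^sup>1 B\<close>.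
\<close>

lemma decomposable_row_equiv:
  assumes "row_equiv A B" "decomposable B"
  shows "decomposable A"
proof -
  let ?m = "dim_row B"
  obtain P where P: "unimodular ?m P" and A: "A = P * B"
    using assms(1) by (auto simp: row_equiv_def)
  obtain P' where P': "unimodular ?m P'" "P * P' = 1\<^sub>m ?m" "P' * P = 1\<^sub>m ?m"
    using unimodular_inverse[OF P] by metis
  obtain R R' Q where R: "unimodular ?m R" "R' \<in> carrier_mat ?m ?m"
      "inverts_mat R R'" "inverts_mat R' R" "permutation_matrix (dim_col B) Q"
      "decomposes_into_direct_sum (R' * B * Q)"
    using assms(2) by (auto simp: decomposable_def)
  have c: "P \<in> carrier_mat ?m ?m" "P' \<in> carrier_mat ?m ?m" "R \<in> carrier_mat ?m ?m"
    using P P'(1) R(1) by (auto simp: unimodular_def)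
  have RR: "R * R' = 1\<^sub>m ?m" "R' * R = 1\<^sub>m ?m"
    using R(2-4) c by (auto simp: inverts_mat_def)
  have "(P * R) * (R' * P') = P * (R * R') * P'"
    using c R(2) by (simp add: assoc_mult_mat[of _ ?m ?m _ ?m _ ?m])
  then have 1: "(P * R) * (R' * P') = 1\<^sub>m ?m"
    using RR P' c by simp
  have "(R' * P') * (P * R) = R' * (P' * P) * R"
    using c R(2) by (simp add: assoc_mult_mat[of _ ?m ?m _ ?m _ ?m])
  then have 2: "(R' * P') * (P * R) = 1\<^sub>m ?m"
    using RR P' c R(2) by simp
  have "R' * P' * A = R' * (P' * P) * B"
    unfolding A using c R(2)
    by (simp add: assoc_mult_mat[of _ ?m ?m _ ?m _ "dim_col B"] assoc_mult_mat[of _ ?m ?m _ ?m _ ?m])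
  then have 3: "R' * P' * A = R' * B"
    using P' R(2) by simp
  have "unimodular ?m (P * R)"
    using P R(1) by (rule unimodular_mult)
  moreover have "R' * P' \<in> carrier_mat ?m ?m"
    using c R(2) by simp
  ultimately show ?thesis
    unfolding decomposable_def using 1 2 3 R(2,5,6) c row_equiv_dim[OF assms(1)]
    by (intro exI[of _ "P * R"] exI[of _ "R' * P'"] exI[of _ Q]) (auto simp: inverts_mat_def)
qed

lemma row_equiv_swaprows:
  assumes "k < dim_row A" "l < dim_row A"
  shows "row_equiv (swaprows k l A) A"
proof (cases "k = l")
  case True
  then have "swaprows k l A = A"
    by (intro eq_matI) auto
  then show ?thesis
    by (simp add: row_equiv_refl)
next
  case False
  then have "unimodular (dim_row A) (swaprows_mat (dim_row A) k l)"
    using assms by (simp add: unimodular_def det_swaprows_mat)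
  then show ?thesis
    using swaprows_mat[of A "dim_row A" "dim_col A" k l] assms by (auto simp: row_equiv_def)
qed

lemma row_equiv_negate_row:
  assumes "k < dim_row A"
  shows "row_equiv (multrow k (- 1) A) A"
proof -
  have "unimodular (dim_row A) (multrow_mat (dim_row A) k (- 1))"
    using assms by (simp add: unimodular_def det_multrow_mat)
  then show ?thesis
    using multrow_mat[of A "dim_row A" "dim_col A" k "- 1"] by (auto simp: row_equiv_def)
qed

lemma row_equiv_addrow:
  assumes "k \<noteq> l" "l < dim_row A"
  shows "row_equiv (addrow a k l A) A"
proof -
  have "unimodular (dim_row A) (addrow_mat (dim_row A) a k l)"
    using assms by (simp add: unimodular_def det_addrow_mat)
  then show ?thesis
    using addrow_mat[of A "dim_row A" "dim_col A" l a k] assms by (auto simp: row_equiv_def)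
qed

text \<open>
  Clearing a whole column in one go. The multipliers can all be read from the original matrix
  since row \<open>l\<close> itself stays fixed.
\<close>

lemma row_equiv_add_multiples:
  assumes l: "l < dim_row A" and K: "finite K" "l \<notin> K"
  shows "row_equiv (mat (dim_row A) (dim_col A)
           (\<lambda>(k, j). A $$ (k, j) + (if k \<in> K then q k * A $$ (l, j) else 0))) A"
    (is "row_equiv (?M K) A")
  using K
proof (induction K rule: finite_induct)
  case empty
  have "?M {} = A"
    by (intro eq_matI) auto
  then show ?case
    by (simp add: row_equiv_refl)
next
  case (insert k K)
  have "?M (insert k K) = addrow (q k) k l (?M K)"
    using insert l by (intro eq_matI) auto
  moreover have "row_equiv (addrow (q k) k l (?M K)) (?M K)"
    using insert l by (intro row_equiv_addrow) auto
  ultimately show ?case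
    using insert row_equiv_trans by auto
qed

section \<open>Existence of Hermite echelon forms\<close>

text \<open>
  The conditions of the Hermite normal form, imposed on the first \<open>c\<close> columns only. This is the
  invariant of the column-by-column construction; at \<open>c = dim_col H\<close> it is the full condition, with
  the number \<open>r\<close> of pivots left free instead of being tied to a rank.
\<close>

definition hermite_shape :: "nat \<Rightarrow> nat \<Rightarrow> (nat \<Rightarrow> nat) \<Rightarrow> int mat \<Rightarrow> bool" where
  "hermite_shape c r piv H \<longleftrightarrow> r \<le> dim_row H \<and>
     strict_mono_on {..<r} piv \<and> (\<forall>i<r. piv i < c) \<and>
     (\<forall>i<r. (\<forall>j<piv i. H $$ (i, j) = 0) \<and> 0 < H $$ (i, piv i)) \<and>
     (\<forall>i<r. \<forall>k<i. 0 \<le> H $$ (k, piv i) \<and> H $$ (k, piv i) < H $$ (i, piv i)) \<and>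
     (\<forall>i j. r \<le> i \<longrightarrow> i < dim_row H \<longrightarrow> j < c \<longrightarrow> H $$ (i, j) = 0)"

lemma hermite_shape_cong:
  assumes "hermite_shape c r piv H" "dim_row H' = dim_row H"
    and "\<And>i j. i < dim_row H \<Longrightarrow> j < c \<Longrightarrow> H' $$ (i, j) = H $$ (i, j)"
  shows "hermite_shape c r piv H'"
proof -
  have *: "H' $$ (i, j) = H $$ (i, j)" if "i < r" "j < c" for i j
    using assms that by (auto simp: hermite_shape_def)
  have p: "piv i < c" "j < piv i \<Longrightarrow> j < c" if "i < r" for i j
    using assms(1) that by (auto simp: hermite_shape_def dest: less_trans)
  have l: "k < r" if "k < i" "i < r" for i k :: nat
    using that by simp
  show ?thesis
    using assms unfolding hermite_shape_def by (simp add: * p l)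
qed

text \<open>How a new pivot is accepted: \<open>r\<close> is the first row without a pivot and \<open>c\<close> the next column.\<close>

lemma hermite_shape_Suc:
  assumes "hermite_shape c r piv H" and r: "r < dim_row H" and pos: "0 < H $$ (r, c)"
    and above: "\<And>k. k < r \<Longrightarrow> 0 \<le> H $$ (k, c) \<and> H $$ (k, c) < H $$ (r, c)"
    and below: "\<And>k. r < k \<Longrightarrow> k < dim_row H \<Longrightarrow> H $$ (k, c) = 0"
  shows "hermite_shape (Suc c) (Suc r) (piv(r := c)) H"
proof -
  have "strict_mono_on {..<Suc r} (piv(r := c))"
    using assms(1) by (auto simp: hermite_shape_def strict_mono_on_def less_Suc_eq)
  then show ?thesis
    using assms unfolding hermite_shape_def by (auto simp: less_Suc_eq)
qed

text \<open>
  If column \<open>c\<close> has a nonzero entry in a row without a pivot, take among all matrices row equivalent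
  to \<open>A\<close> that keep the shape an entry of this kind with least absolute value. Swapping it into row
  \<open>r\<close>, making it positive and reducing all other rows modulo it yields the next pivot. Nothing
  changes to the left of column \<open>c\<close>, because the rows from \<open>r\<close> on are zero there.
\<close>

lemma hermite_shape_extend_column:
  assumes A: "hermite_shape c r piv A" and c: "c < dim_col A"
  shows "\<exists>r' piv' B. row_equiv B A \<and> hermite_shape (Suc c) r' piv' B"
proof (cases "\<forall>i. r \<le> i \<and> i < dim_row A \<longrightarrow> A $$ (i, c) = 0")
  case True
  then have "hermite_shape (Suc c) r piv A"
    using A by (auto simp: hermite_shape_def less_Suc_eq)
  then show ?thesis
    using row_equiv_refl by blast
next
  case False
  let ?m = "dim_row A"
  let ?cand = "\<lambda>(C, i). row_equiv C A \<and> hermite_shape c r piv C \<and> r \<le> i \<and> i < ?m \<and> C $$ (i, c) \<noteq> 0"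
  let ?size = "\<lambda>(C, i). nat \<bar>C $$ (i, c)\<bar>"
  obtain i\<^sub>0 where "?cand (A, i\<^sub>0)"
    using False A row_equiv_refl by auto
  then obtain x where x: "?cand x" and "\<forall>y. ?cand y \<longrightarrow> ?size x \<le> ?size y"
    using ex_has_least_nat[of ?cand _ ?size] by blast
  moreover obtain C i where Ci: "x = (C, i)"
    by (cases x)
  ultimately have C: "row_equiv C A" "hermite_shape c r piv C" and i: "r \<le> i" "i < ?m"
    and nz: "C $$ (i, c) \<noteq> 0"
    and least: "\<And>D k. row_equiv D A \<Longrightarrow> hermite_shape c r piv D \<Longrightarrow> r \<le> k \<Longrightarrow> k < ?m \<Longrightarrow>
      D $$ (k, c) \<noteq> 0 \<Longrightarrow> \<bar>C $$ (i, c)\<bar> \<le> \<bar>D $$ (k, c)\<bar>"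
    by fastforce+
  have dC: "dim_row C = ?m" "dim_col C = dim_col A"
    using C(1) by (auto dest: row_equiv_dim)
  have zero: "C $$ (k, j) = 0" if "r \<le> k" "k < ?m" "j < c" for k j
    using C(2) that dC by (auto simp: hermite_shape_def)
  \<comment> \<open>\<open>D\<close> moves the least entry to row \<open>r\<close>, \<open>E\<close> makes it positive, \<open>F\<close> reduces the other rows
    modulo it, above and below at once.\<close>
  define D where "D = swaprows r i C"
  define E where "E = (if D $$ (r, c) < 0 then multrow r (- 1) D else D)"
  define F where "F = mat ?m (dim_col A) (\<lambda>(k, j). E $$ (k, j) +
    (if k \<in> {..<?m} - {r} then - (E $$ (k, c) div E $$ (r, c)) * E $$ (r, j) else 0))"
  have D: "row_equiv D C"
    unfolding D_def using i dC by (intro row_equiv_swaprows) auto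
  have dD: "dim_row D = ?m" "dim_col D = dim_col A"
    using D dC by (auto dest: row_equiv_dim)
  have E: "row_equiv E D"
    unfolding E_def using i dD by (auto intro: row_equiv_negate_row row_equiv_refl)
  have dE: "dim_row E = ?m" "dim_col E = dim_col A"
    using E dD by (auto dest: row_equiv_dim)
  have "row_equiv F E"
    unfolding F_def using row_equiv_add_multiples[of r E "{..<?m} - {r}"] i dE by simp
  then have F: "row_equiv F A"
    using E D C(1) row_equiv_trans by blast
  have rc: "E $$ (r, c) = \<bar>C $$ (i, c)\<bar>"
    using i c dC dD by (simp add: E_def D_def)
  have E_left: "E $$ (k, j) = C $$ (k, j)" if "k < ?m" "j < c" for k j
    using that i c dC dD zero by (auto simp: E_def D_def)
  have F_left: "F $$ (k, j) = C $$ (k, j)" if "k < ?m" "j < c" for k j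
    using that i c E_left zero by (auto simp: F_def)
  have F_r: "F $$ (r, c) = \<bar>C $$ (i, c)\<bar>"
    using i c rc by (simp add: F_def)
  have F_mod: "F $$ (k, c) = E $$ (k, c) mod \<bar>C $$ (i, c)\<bar>" if "k < ?m" "k \<noteq> r" for k
    using that c by (simp add: F_def rc minus_div_mult_eq_mod[symmetric])
  have F_range: "0 \<le> F $$ (k, c) \<and> F $$ (k, c) < \<bar>C $$ (i, c)\<bar>" if "k < ?m" "k \<noteq> r" for k
    using F_mod[OF that] nz by simp
  have shape: "hermite_shape c r piv F"
    by (rule hermite_shape_cong[OF C(2)]) (use F_left dC in \<open>auto simp: F_def\<close>)
  have "hermite_shape (Suc c) (Suc r) (piv(r := c)) F"
  proof (rule hermite_shape_Suc[OF shape])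
    show "r < dim_row F"
      using i by (simp add: F_def)
    show "0 < F $$ (r, c)"
      using F_r nz by simp
    show "0 \<le> F $$ (k, c) \<and> F $$ (k, c) < F $$ (r, c)" if "k < r" for k
      using F_range[of k] F_r that i by simp
    \<comment> \<open>A nonzero remainder below the pivot would be a smaller candidate.\<close>
    show "F $$ (k, c) = 0" if "r < k" "k < dim_row F" for k
      using F_range[of k] least[OF F shape, of k] that by (force simp: F_def)
  qed
  then show ?thesis
    using F by blast
qed

lemma hermite_shape_exists:
  assumes "c \<le> dim_col A"
  shows "\<exists>r piv H. row_equiv H A \<and> hermite_shape c r piv H"
  using assms
proof (induction c)
  case 0
  have "hermite_shape 0 0 id A"
    by (simp add: hermite_shape_def strict_mono_on_def)
  then show ?case
    using row_equiv_refl by blast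
next
  case (Suc c)
  then obtain r piv H where "row_equiv H A" "hermite_shape c r piv H"
    by auto
  then show ?case
    using hermite_shape_extend_column[of c r piv H] row_equiv_trans row_equiv_dim Suc.prems
    by (metis Suc_le_lessD)
qed

section \<open>Uniqueness through the row lattice\<close>

text \<open>
  Lattice vectors are functions on all column indices whose values from \<open>dim_col H\<close> on are
  unconstrained; this lets entries be manipulated without carrying dimensions along.
\<close>

definition row_lattice :: "int mat \<Rightarrow> (nat \<Rightarrow> int) set" where
  "row_lattice H = {w. \<exists>x. \<forall>j<dim_col H. w j = (\<Sum>i<dim_row H. x i * H $$ (i, j))}"

lemma row_lattice_row:
  assumes "i < dim_row H"
  shows "(\<lambda>j. H $$ (i, j)) \<in> row_lattice H"
  unfolding row_lattice_def
  using assms by (auto intro!: exI[of _ "\<lambda>k. if k = i then 1 else 0"] simp: if_distrib[of "\<lambda>x. x * _"] cong: if_cong)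

lemma row_lattice_diff:
  assumes "v \<in> row_lattice H" "w \<in> row_lattice H"
  shows "(\<lambda>j. v j - w j) \<in> row_lattice H"
proof -
  obtain x y where "\<forall>j<dim_col H. v j = (\<Sum>i<dim_row H. x i * H $$ (i, j))"
    "\<forall>j<dim_col H. w j = (\<Sum>i<dim_row H. y i * H $$ (i, j))"
    using assms by (auto simp: row_lattice_def)
  then have "\<forall>j<dim_col H. v j - w j = (\<Sum>i<dim_row H. (x i - y i) * H $$ (i, j))"
    by (simp add: left_diff_distrib sum_subtractf)
  then show ?thesis
    unfolding row_lattice_def by (intro CollectI exI[of _ "\<lambda>i. x i - y i"])
qed

lemma row_lattice_row_equiv_subset:
  assumes "row_equiv A B"
  shows "row_lattice A \<subseteq> row_lattice B"
proof
  fix w assume "w \<in> row_lattice A"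
  then obtain x where x: "\<And>j. j < dim_col A \<Longrightarrow> w j = (\<Sum>i<dim_row A. x i * A $$ (i, j))"
    by (auto simp: row_lattice_def)
  obtain P where P: "unimodular (dim_row B) P" "A = P * B"
    using assms by (auto simp: row_equiv_def)
  let ?m = "dim_row B"
  have dP: "dim_row P = ?m" "dim_col P = ?m"
    using P(1) by (auto simp: unimodular_def)
  have "w j = (\<Sum>k<?m. (\<Sum>i<?m. x i * P $$ (i, k)) * B $$ (k, j))" if "j < dim_col B" for j
  proof -
    have "A $$ (i, j) = (\<Sum>k<?m. P $$ (i, k) * B $$ (k, j))" if "i < ?m" for i
      using that \<open>j < dim_col B\<close> dP P(2) by (simp add: scalar_prod_def lessThan_atLeast0)
    then have "w j = (\<Sum>i<?m. \<Sum>k<?m. x i * P $$ (i, k) * B $$ (k, j))"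
      using x[of j] that row_equiv_dim[OF assms] by (simp add: sum_distrib_left mult.assoc)
    also have "\<dots> = (\<Sum>k<?m. \<Sum>i<?m. x i * P $$ (i, k) * B $$ (k, j))"
      by (rule sum.swap)
    finally show ?thesis
      by (simp add: sum_distrib_right)
  qed
  then show "w \<in> row_lattice B"
    unfolding row_lattice_def by (intro CollectI exI[of _ "\<lambda>k. \<Sum>i<?m. x i * P $$ (i, k)"]) simp
qed

lemma row_lattice_row_equiv:
  assumes "row_equiv A B"
  shows "row_lattice A = row_lattice B"
  using assms row_equiv_sym row_lattice_row_equiv_subset by blast

text \<open>
  Take the first row \<open>i\<close> with a nonzero coefficient in the combination \<open>w\<close>. All later rows are zero
  up to and including column \<open>piv i\<close>, so up to there \<open>w\<close> is a nonzero multiple of row \<open>i\<close>.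
\<close>

lemma row_lattice_leading_entry:
  assumes H: "hermite_shape (dim_col H) r piv H" and w: "w \<in> row_lattice H"
    and j: "j < dim_col H" "w j \<noteq> 0"
  obtains i where "i < r" "w (piv i) \<noteq> 0" "H $$ (i, piv i) dvd w (piv i)" "\<And>j. j < piv i \<Longrightarrow> w j = 0"
proof -
  obtain x where x: "\<And>j. j < dim_col H \<Longrightarrow> w j = (\<Sum>i<dim_row H. x i * H $$ (i, j))"
    using w by (auto simp: row_lattice_def)
  have zero: "H $$ (k, l) = 0" if "r \<le> k" "k < dim_row H" "l < dim_col H" for k l
    using H that by (auto simp: hermite_shape_def)
  have "\<exists>i. i < r \<and> x i \<noteq> 0"
  proof (rule ccontr)
    assume "\<not> ?thesis"
    then have "x k * H $$ (k, j) = 0" if "k < dim_row H" for k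
      using zero[of k j] that j by (cases "k < r") auto
    then have "(\<Sum>k<dim_row H. x k * H $$ (k, j)) = 0"
      by (intro sum.neutral) simp
    then show False
      using x[OF j(1)] j(2) by simp
  qed
  then obtain i where i: "i < r" "x i \<noteq> 0" and least: "\<And>k. k < i \<Longrightarrow> x k = 0"
    using exists_least_iff[of "\<lambda>i. i < r \<and> x i \<noteq> 0"] by (metis less_trans)
  have ir: "i < dim_row H" and p: "piv i < dim_col H" and pos: "0 < H $$ (i, piv i)"
    and before: "\<And>j. j < piv i \<Longrightarrow> H $$ (i, j) = 0"
    using H i by (auto simp: hermite_shape_def)
  have *: "w l = x i * H $$ (i, l)" if l: "l \<le> piv i" for l
  proof -
    have "x k * H $$ (k, l) = 0" if k: "k < dim_row H" "k \<noteq> i" for k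
    proof -
      consider "k < i" | "i < k" "k < r" | "r \<le> k"
        using k by linarith
      then show ?thesis
      proof cases
        case 2
        then have "piv i < piv k"
          using H by (auto simp: hermite_shape_def strict_mono_on_def)
        then show ?thesis
          using H 2 l by (auto simp: hermite_shape_def)
      qed (use least zero k l p in auto)
    qed
    then have "(\<Sum>k<dim_row H. x k * H $$ (k, l)) = (\<Sum>k\<in>{i}. x k * H $$ (k, l))"
      using ir by (intro sum.mono_neutral_right) auto
    then show ?thesis
      using x[of l] l p by simp
  qed
  show thesis
  proof (rule that[OF i(1)])
    show "w (piv i) \<noteq> 0" "H $$ (i, piv i) dvd w (piv i)"
      using *[of "piv i"] i pos by auto
    show "w j = 0" if "j < piv i" for j
      using *[of j] before that by simp
  qed
qed

text \<open>
  A pivot row of one form is a lattice vector of the other, hence starts in one of its pivot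
  columns. Applied in both directions, this identifies the pivot columns and, by mutual
  divisibility of positive numbers, the pivots.
\<close>

lemma pivot_in_row_lattice:
  assumes H: "hermite_shape (dim_col H) r piv H" and H': "hermite_shape (dim_col H') r' piv' H'"
    and dim: "dim_col H = dim_col H'" and sub: "row_lattice H \<subseteq> row_lattice H'" and i: "i < r"
  obtains i' where "i' < r'" "piv' i' = piv i" "H' $$ (i', piv i) dvd H $$ (i, piv i)"
proof -
  have i': "i < dim_row H" "piv i < dim_col H'" "H $$ (i, piv i) \<noteq> 0"
    and before: "\<And>j. j < piv i \<Longrightarrow> H $$ (i, j) = 0"
    using H i dim by (force simp: hermite_shape_def)+
  have "(\<lambda>j. H $$ (i, j)) \<in> row_lattice H'"
    using sub row_lattice_row[OF i'(1)] by blast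
  from row_lattice_leading_entry[OF H' this i'(2,3)]
  obtain k where k: "k < r'" "H $$ (i, piv' k) \<noteq> 0" "H' $$ (k, piv' k) dvd H $$ (i, piv' k)"
      "\<And>j. j < piv' k \<Longrightarrow> H $$ (i, j) = 0"
    by blast
  have "piv' k = piv i"
    using before[of "piv' k"] k(2) k(4)[of "piv i"] i'(3) by (metis nat_neq_iff)
  then show thesis
    using k that[of k] by simp
qed

lemma strict_mono_on_image_eq:
  fixes f g :: "nat \<Rightarrow> nat"
  assumes f: "strict_mono_on {..<r} f" and g: "strict_mono_on {..<s} g"
    and eq: "f ` {..<r} = g ` {..<s}"
  shows "r = s" "\<And>i. i < r \<Longrightarrow> f i = g i"
proof -
  have "card (f ` {..<r}) = r" "card (g ` {..<s}) = s"
    using strict_mono_on_imp_inj_on[OF f] strict_mono_on_imp_inj_on[OF g] by (simp_all add: card_image)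
  then show rs: "r = s"
    using eq by simp
  show "f i = g i" if "i < r" for i
    using that
  proof (induction i rule: less_induct)
    case (less i)
    have "f i \<in> g ` {..<s}" "g i \<in> f ` {..<r}"
      using eq less.prems rs by blast+
    then obtain k l where k: "k < r" "f i = g k" and l: "l < r" "g i = f l"
      using rs by auto
    have f_less: "a < b \<Longrightarrow> b < r \<Longrightarrow> f a < f b" and g_less: "a < b \<Longrightarrow> b < r \<Longrightarrow> g a < g b" for a b
      using f g rs by (auto simp: strict_mono_on_def)
    have "\<not> k < i"
      using less.IH[of k] k f_less[of k i] less.prems by auto
    moreover have "\<not> l < i"
      using less.IH[of l] l g_less[of l i] less.prems by auto
    ultimately consider "k = i" | "l = i" | "i < k" "i < l"
      by linarith
    then show ?case
      using k l f_less[of i l] g_less[of i k] by cases auto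
  qed
qed

text \<open>
  With the pivots identified, let \<open>l\<close> be the pivot row that governs the first nonzero entry of the
  difference of the two rows with index \<open>i\<close>. For \<open>l < i\<close> and \<open>l = i\<close> both rows agree in column
  \<open>piv l\<close>; for \<open>l > i\<close> both entries there are residues modulo the pivot, so a nonzero difference
  cannot be a multiple of it.
\<close>

lemma hermite_shape_unique:
  assumes H: "hermite_shape (dim_col H) r piv H" and H': "hermite_shape (dim_col H') r' piv' H'"
    and dim: "dim_row H = dim_row H'" "dim_col H = dim_col H'"
    and lattice: "row_lattice H = row_lattice H'"
  shows "H = H'"
proof -
  have "piv ` {..<r} \<subseteq> piv' ` {..<r'}"
  proof
    fix p assume "p \<in> piv ` {..<r}"
    then obtain i where i: "i < r" "p = piv i"
      by auto
    obtain k where "k < r'" "piv' k = piv i"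
      by (rule pivot_in_row_lattice[OF H H' dim(2) _ i(1)]) (use lattice in auto)
    then show "p \<in> piv' ` {..<r'}"
      using i(2) by (metis imageI lessThan_iff)
  qed
  moreover have "piv' ` {..<r'} \<subseteq> piv ` {..<r}"
  proof
    fix p assume "p \<in> piv' ` {..<r'}"
    then obtain i where i: "i < r'" "p = piv' i"
      by auto
    obtain k where "k < r" "piv k = piv' i"
      by (rule pivot_in_row_lattice[OF H' H dim(2)[symmetric] _ i(1)]) (use lattice in auto)
    then show "p \<in> piv ` {..<r}"
      using i(2) by (metis imageI lessThan_iff)
  qed
  moreover have mono: "strict_mono_on {..<r} piv" "strict_mono_on {..<r'} piv'"
    using H H' by (auto simp: hermite_shape_def)
  ultimately have r: "r = r'" and piv: "\<And>i. i < r \<Longrightarrow> piv i = piv' i"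
    using strict_mono_on_image_eq[of r piv r' piv'] by blast+
  have inj: "inj_on piv {..<r}"
    using mono(1) by (rule strict_mono_on_imp_inj_on)
  have pivot: "H $$ (i, piv i) = H' $$ (i, piv i)" if i: "i < r" for i
  proof -
    obtain k where k: "k < r'" "piv' k = piv i" "H' $$ (k, piv i) dvd H $$ (i, piv i)"
      by (rule pivot_in_row_lattice[OF H H' dim(2) _ i]) (use lattice in auto)
    then have "k = i"
      using inj i r piv[of k] by (auto dest: inj_onD)
    then have "H' $$ (i, piv i) dvd H $$ (i, piv i)"
      using k by simp
    moreover obtain l where l: "l < r" "piv l = piv' i" "H $$ (l, piv' i) dvd H' $$ (i, piv' i)"
      by (rule pivot_in_row_lattice[OF H' H dim(2)[symmetric] _, of i]) (use lattice i r in auto)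
    then have "l = i"
      using inj_onD[OF inj, of l i] i piv[of i] by simp
    then have "H $$ (i, piv i) dvd H' $$ (i, piv i)"
      using l piv[OF i] by simp
    moreover have "0 < H $$ (i, piv i)" "0 < H' $$ (i, piv i)"
      using H H' i r piv by (auto simp: hermite_shape_def)
    ultimately show ?thesis
      by (simp add: zdvd_antisym_nonneg)
  qed
  show ?thesis
  proof (rule eq_matI)
    fix i j assume ij: "i < dim_row H'" "j < dim_col H'"
    let ?d = "\<lambda>j. H $$ (i, j) - H' $$ (i, j)"
    have d: "?d \<in> row_lattice H"
      using row_lattice_diff row_lattice_row[of i H] row_lattice_row[of i H'] lattice dim ij by simp
    show "H $$ (i, j) = H' $$ (i, j)"
    proof (rule ccontr)
      assume "H $$ (i, j) \<noteq> H' $$ (i, j)"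
      then obtain l where l: "l < r" "?d (piv l) \<noteq> 0" "H $$ (l, piv l) dvd ?d (piv l)"
        using row_lattice_leading_entry[OF H d, of j] ij dim by auto
      have pl: "piv l < dim_col H"
        using H l by (auto simp: hermite_shape_def)
      consider "l < i" "i < r" | "l = i" | "i < l" | "r \<le> i"
        by linarith
      then show False
      proof cases
        case 1
        then have "piv l < piv i"
          using mono(1) by (auto simp: strict_mono_on_def)
        then show ?thesis
          using 1 l(2) H H' r piv by (auto simp: hermite_shape_def)
      next
        case 2
        then show ?thesis
          using pivot l by simp
      next
        case 3
        then have "0 \<le> H $$ (i, piv l)" "H $$ (i, piv l) < H $$ (l, piv l)"
          "0 \<le> H' $$ (i, piv l)" "H' $$ (i, piv l) < H $$ (l, piv l)"
          using H H' l(1) r piv pivot[OF l(1)] by (auto simp: hermite_shape_def)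
        then show ?thesis
          using dvd_imp_le_int[OF l(2,3)] by linarith
      next
        case 4
        then show ?thesis
          using H H' l(2) r ij dim pl by (auto simp: hermite_shape_def)
      qed
    qed
  qed (use dim in auto)
qed

section \<open>The number of pivots is the rank\<close>

context vec_space
begin

text \<open>The columns of \<open>B * C\<close> lie in the span of the \<open>k\<close> columns of \<open>B\<close>.\<close>

lemma rank_mult_le:
  assumes B: "B \<in> carrier_mat n k" and C: "C \<in> carrier_mat k nc"
  shows "rank (B * C) \<le> k"
proof -
  let ?SB = "span (set (cols B))" and ?SA = "span (set (cols (B * C)))"
  have cB: "set (cols B) \<subseteq> carrier_vec n" and cA: "set (cols (B * C)) \<subseteq> carrier_vec n"
    using cols_dim[of B] cols_dim[of "B * C"] B by auto
  have "set (cols (B * C)) \<subseteq> ?SB"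
  proof
    fix v assume "v \<in> set (cols (B * C))"
    then obtain j where j: "j < nc" "v = col (B * C) j"
      using C by (metis cols_length cols_nth in_set_conv_nth index_mult_mat(3) carrier_matD(2))
    then have "v = B *\<^sub>v col C j"
      using col_mult2[OF B C] by simp
    also have "\<dots> = mat_of_cols n (cols B) *\<^sub>v vec (length (cols B)) (($) (col C j))"
      using B C j by (intro arg_cong2[where f = "(*\<^sub>v)"] eq_vecI) auto
    also have "\<dots> = lincomb_list (($) (col C j)) (cols B)"
      using cB by (intro lincomb_list_as_mat_mult[symmetric]) auto
    finally have "v \<in> span_list (cols B)"
      by (auto intro: in_span_listI)
    then show "v \<in> ?SB"
      using span_list_as_span[OF cB] by simp
  qed
  then have "?SA \<subseteq> ?SB"
    using cB by (metis span_subsetI)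
  moreover have "subspace class_ring ?SA V" "subspace class_ring ?SB V"
    using cA cB span_is_subspace by auto
  ultimately have "subspace class_ring ?SA (vs ?SB)"
    using nested_subspaces by blast
  moreover have "vectorspace class_ring (vs ?SB)"
    using \<open>subspace class_ring ?SB V\<close> subspace_is_vs by blast
  ultimately have "rank (B * C) \<le> rank B"
    unfolding rank_def
    using vectorspace.subspace_dim[of class_ring "vs ?SB" ?SA] fin_dim_span_cols[OF B]
      fin_dim_span_cols[of "B * C" nc] B C by simp
  also have "\<dots> \<le> k"
    using B by (rule rank_le_nc)
  finally show ?thesis .
qed

text \<open>
  A matrix \<open>B\<close> with trivial kernel has distinct, independent columns. Distinctness needs its own
  argument, since \<open>set (cols B)\<close> would hide a repetition: two equal columns would put the difference
  of two unit vectors into the kernel.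
\<close>

lemma card_le_rank_if_inj_on_columns:
  assumes A: "A \<in> carrier_mat n nc" and B: "B \<in> carrier_mat n k"
    and cols: "set (cols B) \<subseteq> set (cols A)"
    and inj: "\<And>v. v \<in> carrier_vec k \<Longrightarrow> B *\<^sub>v v = 0\<^sub>v n \<Longrightarrow> v = 0\<^sub>v k"
  shows "k \<le> rank A"
proof -
  have "distinct (cols B)"
  proof (rule ccontr)
    assume "\<not> distinct (cols B)"
    then obtain i j where ij: "i < k" "j < k" "i \<noteq> j" "col B i = col B j"
      using B by (auto simp: distinct_conv_nth)
    let ?v = "unit_vec k i - unit_vec k j :: 'a vec"
    have "B *\<^sub>v unit_vec k l = col B l" if "l < k" for l
      using B that by (intro eq_vecI) auto
    then have "B *\<^sub>v ?v = col B i - col B j"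
      using B ij by (simp add: mult_minus_distrib_mat_vec)
    then have "?v = 0\<^sub>v k"
      using ij B inj[of ?v] by auto
    then have "?v $ i = 0\<^sub>v k $ i"
      by simp
    then show False
      using ij by simp
  qed
  moreover from this have "lin_indpt (set (cols B))"
    using lin_depE[OF B] inj by metis
  ultimately show ?thesis
    using rank_ge_card_indpt[OF A cols] B by (simp add: distinct_card)
qed

end

lemma left_inverse_mat_kernel:
  fixes P :: "'a :: comm_ring_1 mat"
  assumes "P \<in> carrier_mat n n" "P' \<in> carrier_mat n n" "P' * P = 1\<^sub>m n"
    and "v \<in> carrier_vec n" "P *\<^sub>v v = 0\<^sub>v n"
  shows "v = 0\<^sub>v n"
proof -
  have "v = (P' * P) *\<^sub>v v"
    using assms by simp
  also have "\<dots> = P' *\<^sub>v (P *\<^sub>v v)"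
    using assms(2,1,4) by (rule assoc_mult_mat_vec)
  also have "\<dots> = 0\<^sub>v n"
    unfolding assms(5) using assms(2) by (intro eq_vecI) auto
  finally show ?thesis .
qed

text \<open>
  Write \<open>A = P H\<close>. Only the first \<open>r\<close> columns of \<open>P\<close> and rows of \<open>H\<close> contribute to the product,
  which bounds the rank by \<open>r\<close>. Conversely, the pivot columns of \<open>A\<close> are \<open>P E\<close>, where \<open>E\<close>
  consists of the pivot columns of \<open>H\<close>; \<open>P\<close> is injective over the rationals, and \<open>E\<close> is upper
  triangular with nonzero diagonal.
\<close>

lemma hermite_shape_rank:
  assumes A: "row_equiv A H" and H: "hermite_shape (dim_col H) r piv H"
  shows "int_mat_rank A = r"
proof -
  let ?m = "dim_row H" and ?n = "dim_col H"
  let ?q = "map_mat rat_of_int"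
  let ?rank = "vec_space.rank ?m :: rat mat \<Rightarrow> nat"
  obtain P where P: "unimodular ?m P" "A = P * H"
    using A by (auto simp: row_equiv_def)
  obtain P' where P': "unimodular ?m P'" "P' * P = 1\<^sub>m ?m"
    using unimodular_inverse[OF P(1)] by metis
  have c: "P \<in> carrier_mat ?m ?m" "P' \<in> carrier_mat ?m ?m" "H \<in> carrier_mat ?m ?n" "A \<in> carrier_mat ?m ?n"
    using P P'(1) by (auto simp: unimodular_def)
  have d: "dim_row P = ?m" "dim_col P = ?m" "dim_row A = ?m" "dim_col A = ?n"
    by (fact carrier_matD[OF c(1)] carrier_matD[OF c(4)])+
  have r: "r \<le> ?m" and zero: "\<And>i j. r \<le> i \<Longrightarrow> i < ?m \<Longrightarrow> j < ?n \<Longrightarrow> H $$ (i, j) = 0"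
    and piv: "\<And>i. i < r \<Longrightarrow> piv i < ?n"
    using H by (auto simp: hermite_shape_def)
  have qA: "?q A = ?q P * ?q H"
    unfolding P(2) by (rule of_int_hom.mat_hom_mult[OF c(1,3)])
  have qP: "?q P' * ?q P = 1\<^sub>m ?m"
    using of_int_hom.mat_hom_mult[OF c(2,1)] P'(2) by (metis of_int_hom.mat_hom_one)
  have qc: "?q P \<in> carrier_mat ?m ?m" "?q P' \<in> carrier_mat ?m ?m"
    using c(1,2) by (simp_all only: map_carrier_mat)
  have inj: "v = 0\<^sub>v ?m" if "v \<in> carrier_vec ?m" "?q P *\<^sub>v v = 0\<^sub>v ?m" for v
    using qc qP that by (rule left_inverse_mat_kernel)
  have "?rank (?q A) \<le> r"
  proof -
    let ?B = "mat ?m r (\<lambda>ij. rat_of_int (P $$ ij))" and ?C = "mat r ?n (\<lambda>ij. rat_of_int (H $$ ij))"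
    have "?q A = ?B * ?C"
    proof (rule eq_matI)
      fix i j assume "i < dim_row (?B * ?C)" "j < dim_col (?B * ?C)"
      then have ij: "i < ?m" "j < ?n"
        by auto
      have "A $$ (i, j) = (\<Sum>k<?m. P $$ (i, k) * H $$ (k, j))"
        using ij d(1,2) unfolding P(2) by (simp add: scalar_prod_def lessThan_atLeast0)
      then have "?q A $$ (i, j) = (\<Sum>k<?m. rat_of_int (P $$ (i, k)) * rat_of_int (H $$ (k, j)))"
        using ij d(3,4) by simp
      also have "\<dots> = (\<Sum>k<r. rat_of_int (P $$ (i, k)) * rat_of_int (H $$ (k, j)))"
        using r zero ij by (intro sum.mono_neutral_right) auto
      also have "\<dots> = (?B * ?C) $$ (i, j)"
        using ij by (simp add: scalar_prod_def lessThan_atLeast0)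
      finally show "?q A $$ (i, j) = (?B * ?C) $$ (i, j)" .
    qed (use d(3,4) in auto)
    then show ?thesis
      using vec_space.rank_mult_le[of ?B ?m r ?C ?n] by simp
  qed
  moreover have "r \<le> ?rank (?q A)"
  proof (rule vec_space.card_le_rank_if_inj_on_columns)
    let ?E = "mat ?m r (\<lambda>(i, k). rat_of_int (H $$ (i, piv k)))"
    let ?B = "?q P * ?E"
    show "?q A \<in> carrier_mat ?m ?n" "?B \<in> carrier_mat ?m r"
      using d by auto
    have "col ?B k = col (?q A) (piv k)" if "k < r" for k
    proof -
      have "col ?E k = col (?q H) (piv k)"
        using that piv by (intro eq_vecI) auto
      then show ?thesis
        unfolding qA using that piv
        by (subst (1 2) col_mult2[OF qc(1)]) auto
    qed
    then show "set (cols ?B) \<subseteq> set (cols (?q A))"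
      using piv d(4) by (force simp: cols_def)
    fix v :: "rat vec" assume v: "v \<in> carrier_vec r" and "?B *\<^sub>v v = 0\<^sub>v ?m"
    then have PEv: "?q P *\<^sub>v (?E *\<^sub>v v) = 0\<^sub>v ?m"
      using qc(1) v by (subst assoc_mult_mat_vec[symmetric, of _ ?m ?m _ r]) auto
    have "?E *\<^sub>v v \<in> carrier_vec ?m"
      using v by (intro mult_mat_vec_carrier[of _ _ r]) auto
    then have Ev: "?E *\<^sub>v v = 0\<^sub>v ?m"
      using PEv by (rule inj)
    show "v = 0\<^sub>v r"
    proof (rule ccontr)
      assume "v \<noteq> 0\<^sub>v r"
      \<comment> \<open>Back substitution: row \<open>k\<close> of \<open>E v = 0\<close> involves no earlier column, so for the last
        nonzero coordinate \<open>k\<close> of \<open>v\<close> it reduces to its diagonal term.\<close>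
      moreover define K where "K = {i. i < r \<and> v $ i \<noteq> 0}"
      ultimately have K: "finite K" "K \<noteq> {}"
        using v by auto
      define k where "k = Max K"
      have k: "k < r" "v $ k \<noteq> 0"
        using Max_in[OF K] by (simp_all add: k_def K_def)
      have max: "l \<le> k" if "l < r" "v $ l \<noteq> 0" for l
        using Max_ge[OF K(1), of l] that by (simp add: k_def K_def)
      have "rat_of_int (H $$ (k, piv l)) * v $ l = 0" if "l < r" "l \<noteq> k" for l
      proof (cases "l < k")
        case True
        then have "piv l < piv k"
          using H k by (auto simp: hermite_shape_def strict_mono_on_def)
        then show ?thesis
          using H k by (auto simp: hermite_shape_def)
      qed (use max[of l] that in auto)
      then have "(\<Sum>l<r. rat_of_int (H $$ (k, piv l)) * v $ l) = (\<Sum>l\<in>{k}. rat_of_int (H $$ (k, piv l)) * v $ l)"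
        using k by (intro sum.mono_neutral_right) auto
      moreover have "(?E *\<^sub>v v) $ k = (\<Sum>l<r. rat_of_int (H $$ (k, piv l)) * v $ l)"
        using k r v by (simp add: scalar_prod_def lessThan_atLeast0)
      ultimately show False
        using Ev k r H by (auto simp: hermite_shape_def)
    qed
  qed
  ultimately show ?thesis
    using d(3) by (simp add: int_mat_rank_def)
qed

section \<open>The Hermite normal form\<close>

text \<open>
  The rank in the definition may be replaced by an arbitrary number of pivots, since the pivots
  count the rank anyway. From left to right, the bound of the rank by the number of rows comes from
  comparing with some form that is known to exist.
\<close>

lemma is_hermite_normal_form_iff:
  "is_hermite_normal_form A H \<longleftrightarrow> row_equiv A H \<and> (\<exists>r piv. hermite_shape (dim_col H) r piv H)"
proof
  assume HNF: "is_hermite_normal_form A H"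
  let ?r = "int_mat_rank A"
  have d: "dim_row H = dim_row A" "dim_col H = dim_col A"
    using HNF by (auto simp: is_hermite_normal_form_def)
  have A: "row_equiv A H"
    using HNF unfolding is_hermite_normal_form_def row_equiv_def d(1) by blast
  obtain r piv K where K: "row_equiv K A" "hermite_shape (dim_col A) r piv K"
    using hermite_shape_exists[of "dim_col A" A] by auto
  have dK: "dim_row K = dim_row A" "dim_col K = dim_col A"
    using row_equiv_dim[OF K(1)] .
  then have "?r = r"
    using hermite_shape_rank[OF row_equiv_sym[OF K(1)], of r piv] K(2) by simp
  then have le: "?r \<le> dim_row H"
    using K(2) dK d by (simp add: hermite_shape_def)
  have "\<exists>piv. hermite_shape (dim_col H) ?r piv H"
    unfolding hermite_shape_def
    using HNF[unfolded is_hermite_normal_form_def Let_def, folded d] le by blast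
  then show "row_equiv A H \<and> (\<exists>r piv. hermite_shape (dim_col H) r piv H)"
    using A by blast
next
  assume "row_equiv A H \<and> (\<exists>r piv. hermite_shape (dim_col H) r piv H)"
  then obtain r piv where A: "row_equiv A H" and H: "hermite_shape (dim_col H) r piv H"
    by blast
  have r: "int_mat_rank A = r"
    using hermite_shape_rank[OF A H] .
  show "is_hermite_normal_form A H"
    unfolding is_hermite_normal_form_def Let_def r row_equiv_dim[OF A]
    using A[unfolded row_equiv_def] H[unfolded hermite_shape_def] by blast
qed

lemma ex1_hermite_normal_form: "\<exists>!H. is_hermite_normal_form A H"
proof (rule ex_ex1I)
  obtain r piv H where H: "row_equiv H A" "hermite_shape (dim_col A) r piv H"
    using hermite_shape_exists[of "dim_col A" A] by auto
  then show "\<exists>H. is_hermite_normal_form A H"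
    using row_equiv_sym[OF H(1)] row_equiv_dim[OF H(1)] H(2)
    unfolding is_hermite_normal_form_iff by (intro exI[of _ H]) auto
next
  fix H H' assume "is_hermite_normal_form A H" "is_hermite_normal_form A H'"
  then obtain r piv r' piv' where H: "row_equiv A H" "hermite_shape (dim_col H) r piv H"
    and H': "row_equiv A H'" "hermite_shape (dim_col H') r' piv' H'"
    by (auto simp: is_hermite_normal_form_iff)
  have "row_equiv H H'"
    using row_equiv_sym[OF H(1)] H'(1) by (rule row_equiv_trans)
  then show "H = H'"
    using hermite_shape_unique[OF H(2) H'(2)] row_lattice_row_equiv row_equiv_dim by blast
qed

theorem proposition2p4:
  fixes A H :: "int mat" and m n :: nat
  assumes "A \<in> carrier_mat m n"
    and "H = hermite_normal_form A"
  shows "decomposable A \<longleftrightarrow> decomposable H"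
proof -
  have "is_hermite_normal_form A H"
    unfolding assms(2) hermite_normal_form_def by (rule theI'[OF ex1_hermite_normal_form])
  then have "row_equiv A H"
    by (simp add: is_hermite_normal_form_iff)
  then show ?thesis
    using decomposable_row_equiv row_equiv_sym by blast
qed

end
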